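(* Suppose that $u:\mathbb{D}\to\mathbb{C}$ and $\varphi:\mathbb{D}\to\mathbb{D}$ are holomorphic functions and that the operator $W_{u,\varphi}:\mathcal{B}^{v_{\log}}\to H_{v_{\log}}^\infty$ is continuous. Then there exists a constant $C>0$ such that $$\|W_{u,\varphi}\|_e^{\mathcal{B}^{v_{\log}}\to H_{v_{\log}}^\infty}\le C\limsup_{n\to\infty}\frac{\|u\varphi^n\|_{H_{v_{\log}}^\infty}}{\|g_n\|_{H_{w_{\log}}^\infty}}.$$
   Context: $\mathbb{D}$ is the open unit disk of $\mathbb{C}$ and $H(\mathbb{D})$ is the space of holomorphic functions on $\mathbb{D}$. A weight is a bounded, continuous, positive function $v:\mathbb{D}\to(0,\infty)$. For a weight $v$, $H_v^\infty$ is the Banach space of all $f\in H(\mathbb{D})$ with $\|f\|_{H_v^\infty}=\sup_{z\in\mathbb{D}}v(z)|f(z)|<\infty$, and $\mathcal{B}^v$ is the Banach space of all $f\in H(\mathbb{D})$ with $f'\in H_v^\infty$, normed by $\|f\|_{\mathcal{B}^v}=|f(0)|+\sup_{z\in\mathbb{D}}v(z)|f'(z)|$. The weights used are $v_{\log}(z)=(1-|z|)\log\left(\frac{2}{1-|z|}\right)$ and $w_{\log}(z)=\left[\log\log\left(\frac{4}{1-|z|^2}\right)\right]^{-1}$, $z\in\mathbb{D}$. For holomorphic $u:\mathbb{D}\to\mathbb{C}$ and $\varphi:\mathbb{D}\to\mathbb{D}$, $W_{u,\varphi}(f)=u\cdot(f\circ\varphi)$. $\varphi^n$ is the pointwise $n$-th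 power of $\varphi$; $g_0\equiv1$ and $g_n(z)=z^n$ for $n\ge1$. The essential norm of a continuous linear operator $T:X\to Y$ between Banach spaces is $\|T\|_e^{X\to Y}=\inf\{\|T-K\|^{X\to Y}: K:X\to Y \text{ compact linear operator}\}$, where $\|\cdot\|^{X\to Y}$ is the operator norm. *)

theory Defs
  imports "HOL-Complex_Analysis.Complex_Analysis"
begin

abbreviation disk :: "complex set" where
  "disk \<equiv> ball 0 1"

text \<open>
  A function on the unit disk is represented by its extension by zero to the whole plane.
  Functions agreeing on the disk are then equal, so that the norms below are genuine norms
  and the carriers are closed under pointwise linear combinations.
\<close>

definition on_disk :: "(complex \<Rightarrow> complex) \<Rightarrow> complex \<Rightarrow> complex" where
  "on_disk f = (\<lambda>z. if z \<in> disk then f z else 0)"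

definition hol_disk :: "(complex \<Rightarrow> complex) set" where
  "hol_disk = {f. f holomorphic_on disk \<and> (\<forall>z. z \<notin> disk \<longrightarrow> f z = 0)}"

record fun_space =
  elems :: "(complex \<Rightarrow> complex) set"
  fnorm :: "(complex \<Rightarrow> complex) \<Rightarrow> real"

text \<open>
  The two norms only depend on the values of the function on the disk, so they may also be
  applied to functions that have not been extended by zero.
  They are meaningful only if the supremum is finite, which membership in the space ensures.
\<close>

definition H_inf :: "(complex \<Rightarrow> real) \<Rightarrow> fun_space" where
  "H_inf v = \<lparr> elems = {f \<in> hol_disk. bdd_above ((\<lambda>z. v z * cmod (f z)) ` disk)},
               fnorm = (\<lambda>f. SUP z\<in>disk. v z * cmod (f z)) \<rparr>"

definition Bloch :: "(complex \<Rightarrow> real) \<Rightarrow> fun_space" where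
  "Bloch v = \<lparr> elems = {f \<in> hol_disk. on_disk (deriv f) \<in> elems (H_inf v)},
               fnorm = (\<lambda>f. cmod (f 0) + (SUP z\<in>disk. v z * cmod (deriv f z))) \<rparr>"

definition v_log :: "complex \<Rightarrow> real" where
  "v_log z = (1 - cmod z) * ln (2 / (1 - cmod z))"

definition w_log :: "complex \<Rightarrow> real" where
  "w_log z = inverse (ln (ln (4 / (1 - (cmod z)\<^sup>2))))"

definition wcomp :: "(complex \<Rightarrow> complex) \<Rightarrow> (complex \<Rightarrow> complex)
    \<Rightarrow> (complex \<Rightarrow> complex) \<Rightarrow> complex \<Rightarrow> complex" where
  "wcomp u \<phi> f = on_disk (\<lambda>z. u z * f (\<phi> z))"

type_synonym fun_op = "(complex \<Rightarrow> complex) \<Rightarrow> complex \<Rightarrow> complex"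

definition linear_op :: "fun_space \<Rightarrow> fun_space \<Rightarrow> fun_op \<Rightarrow> bool" where
  "linear_op X Y T \<longleftrightarrow>
     (\<forall>f\<in>elems X. T f \<in> elems Y) \<and>
     (\<forall>f\<in>elems X. \<forall>g\<in>elems X. T (\<lambda>z. f z + g z) = (\<lambda>z. T f z + T g z)) \<and>
     (\<forall>c. \<forall>f\<in>elems X. T (\<lambda>z. c * f z) = (\<lambda>z. c * T f z))"

definition continuous_linear_op :: "fun_space \<Rightarrow> fun_space \<Rightarrow> fun_op \<Rightarrow> bool" where
  "continuous_linear_op X Y T \<longleftrightarrow>
     linear_op X Y T \<and>
     (\<forall>f\<in>elems X. \<forall>\<epsilon>>0. \<exists>\<delta>>0. \<forall>g\<in>elems X.
        fnorm X (\<lambda>z. g z - f z) < \<delta> \<longrightarrow> fnorm Y (\<lambda>z. T g z - T f z) < \<epsilon>)"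

definition compact_linear_op :: "fun_space \<Rightarrow> fun_space \<Rightarrow> fun_op \<Rightarrow> bool" where
  "compact_linear_op X Y K \<longleftrightarrow>
     linear_op X Y K \<and>
     (\<forall>f :: nat \<Rightarrow> complex \<Rightarrow> complex.
        range f \<subseteq> elems X \<and> (\<exists>M. \<forall>n. fnorm X (f n) \<le> M) \<longrightarrow>
        (\<exists>g\<in>elems Y. \<exists>r. strict_mono (r :: nat \<Rightarrow> nat) \<and>
           (\<lambda>n. fnorm Y (\<lambda>z. K (f (r n)) z - g z)) \<longlonglongrightarrow> 0))"

definition op_norm :: "fun_space \<Rightarrow> fun_space \<Rightarrow> fun_op \<Rightarrow> real" where
  "op_norm X Y T = (SUP f\<in>{f \<in> elems X. fnorm X f \<le> 1}. fnorm Y (T f))"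

definition ess_norm :: "fun_space \<Rightarrow> fun_space \<Rightarrow> fun_op \<Rightarrow> real" where
  "ess_norm X Y T = (INF K\<in>{K. compact_linear_op X Y K}. op_norm X Y (\<lambda>f z. T f z - K f z))"

end

theory Submission imports Defs begin

text \<open>
  Write \<open>\<ell>(t) = log log (4 / (1 - t\<^sup>2))\<close>, so that \<open>w_log = 1 / \<ell>(|z|)\<close>. Both weights enter
  through \<open>\<ell>\<close>. On the one hand, integrating \<open>|f'| \<le> \<parallel>f\<parallel> / v_log\<close> along a radius shows that every
  \<open>f\<close> in the Bloch space satisfies \<open>|f(z)| \<le> c \<parallel>f\<parallel> \<ell>(|z|)\<close>, because \<open>1 / v_log\<close> is the derivative of
  \<open>log log (2 / (1 - t))\<close> (\<open>Bloch_growth\<close>). On the other hand, \<open>z\<^sup>n\<close> has \<open>w_log\<close>-norm at most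
  \<open>c' / \<ell>(a)\<close> when \<open>n\<close> is about \<open>1 / (2 (1 - a))\<close>, while \<open>a\<^sup>n\<close> is still at least \<open>1/2\<close>
  (\<open>fnorm_monomial_le\<close>, \<open>power_matching_exponent_ge\<close>).

  Suppose the quotients in the limit superior are eventually at most \<open>M\<close>. Choosing at each point \<open>z\<close>
  the exponent that matches \<open>a = |\<phi>(z)|\<close> gives \<open>v_log(z) |u(z)| \<le> 2 c' M / \<ell>(|\<phi>(z)|)\<close> as soon as
  \<open>|\<phi>(z)|\<close> is close enough to 1 (\<open>weight_le_of_power_norms\<close>).

  The operator is approximated by the dilated operators \<open>K\<^sub>r f = u (f(r \<cdot>) \<circ> \<phi>)\<close> with \<open>r < 1\<close>. They
  are compact by Montel's theorem: they see \<open>f\<close> only on the compact disk of radius \<open>r\<close>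
  (\<open>compact_dilated_wcomp\<close>). For \<open>f\<close> in the unit ball the difference at \<open>z\<close> is
  \<open>u(z) (f(w) - f(r w))\<close> with \<open>w = \<phi>(z)\<close>. Where \<open>|w|\<close> is close to 1, both values are \<open>O(\<ell>(|w|))\<close>,
  which cancels the denominator in the bound for \<open>v_log |u|\<close> and leaves a constant multiple of \<open>M\<close>.
  Where \<open>|w|\<close> stays away from 1, \<open>f'\<close> is uniformly bounded, so the difference is \<open>O(1 - r)\<close> and
  vanishes as \<open>r \<rightarrow> 1\<close>. The resulting constant depends neither on \<open>u\<close> nor on \<open>\<phi>\<close>.
\<close>

section \<open>Weighted supremum norms\<close>

lemma on_disk_in_hol_disk: "f holomorphic_on disk \<Longrightarrow> on_disk f \<in> hol_disk"
  using holomorphic_transform[of f disk "on_disk f"] by (auto simp: hol_disk_def on_disk_def)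

lemma H_inf_iff:
  "f \<in> elems (H_inf v) \<longleftrightarrow> f \<in> hol_disk \<and> (\<exists>B. \<forall>z\<in>disk. v z * cmod (f z) \<le> B)"
  by (auto simp: H_inf_def bdd_above_def)

text \<open>
  The supremum norm is also applied to functions such as \<open>z\<^sup>n\<close> that are not extended by zero and
  hence lie in no carrier; for these an explicit bound replaces membership.
\<close>

lemma fnorm_H_inf_ge:
  assumes "\<And>\<zeta>. \<zeta> \<in> disk \<Longrightarrow> v \<zeta> * cmod (f \<zeta>) \<le> B" and "z \<in> disk"
  shows "v z * cmod (f z) \<le> fnorm (H_inf v) f"
proof -
  have "bdd_above ((\<lambda>z. v z * cmod (f z)) ` disk)"
    using assms(1) by (rule bdd_aboveI2)
  then show ?thesis using assms(2) unfolding H_inf_def by (auto intro: cSUP_upper)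
qed

lemma H_inf_upper:
  assumes "f \<in> elems (H_inf v)" "z \<in> disk"
  shows "v z * cmod (f z) \<le> fnorm (H_inf v) f"
  using assms by (auto simp: H_inf_def intro: cSUP_upper)

lemma fnorm_H_inf_le:
  assumes "\<And>z. z \<in> disk \<Longrightarrow> v z * cmod (f z) \<le> B"
  shows "fnorm (H_inf v) f \<le> B"
  using assms by (auto simp: H_inf_def intro!: cSUP_least)

lemma fnorm_H_inf_nonneg:
  assumes v: "\<And>z. z \<in> disk \<Longrightarrow> 0 \<le> v z" and f: "f \<in> elems (H_inf v)"
  shows "0 \<le> fnorm (H_inf v) f"
  using order_trans[OF mult_nonneg_nonneg[OF v norm_ge_zero] H_inf_upper[OF f], of 0] by simp

lemma weighted_triangle:
  assumes "0 \<le> (c::real)"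
  shows "c * cmod (a - b) \<le> c * cmod a + c * cmod b"
  using mult_left_mono[OF norm_triangle_ineq4 assms, of a b] by (simp add: distrib_left)

lemma H_inf_diff:
  assumes v: "\<And>z. z \<in> disk \<Longrightarrow> 0 \<le> v z"
    and f: "f \<in> elems (H_inf v)" and g: "g \<in> elems (H_inf v)"
  shows "(\<lambda>z. f z - g z) \<in> elems (H_inf v)"
    and "fnorm (H_inf v) (\<lambda>z. f z - g z) \<le> fnorm (H_inf v) f + fnorm (H_inf v) g"
proof -
  have le: "v z * cmod (f z - g z) \<le> fnorm (H_inf v) f + fnorm (H_inf v) g"
    if "z \<in> disk" for z
    using weighted_triangle[OF v[OF that], of "f z" "g z"] H_inf_upper[OF f that] H_inf_upper[OF g that]
    by linarith
  then show "fnorm (H_inf v) (\<lambda>z. f z - g z) \<le> fnorm (H_inf v) f + fnorm (H_inf v) g"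
    by (rule fnorm_H_inf_le)
  have "(\<lambda>z. f z - g z) \<in> hol_disk"
    using f g by (auto simp: H_inf_iff hol_disk_def intro: holomorphic_on_diff)
  then show "(\<lambda>z. f z - g z) \<in> elems (H_inf v)"
    unfolding H_inf_iff using le by blast
qed

lemma fnorm_H_inf_triangle_sub:
  assumes v: "\<And>z. z \<in> disk \<Longrightarrow> 0 \<le> v z"
    and d: "(\<lambda>z. f z - g z) \<in> elems (H_inf v)" and g: "g \<in> elems (H_inf v)"
  shows "fnorm (H_inf v) f \<le> fnorm (H_inf v) (\<lambda>z. f z - g z) + fnorm (H_inf v) g"
proof (rule fnorm_H_inf_le)
  fix z assume z: "z \<in> disk"
  have "v z * cmod (f z) \<le> v z * cmod (f z - g z) + v z * cmod (g z)"
    using mult_left_mono[OF norm_triangle_ineq v[OF z], of "f z - g z" "g z"]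
    by (simp add: distrib_left)
  then show "v z * cmod (f z) \<le> fnorm (H_inf v) (\<lambda>z. f z - g z) + fnorm (H_inf v) g"
    using H_inf_upper[OF d z] H_inf_upper[OF g z] by linarith
qed

section \<open>Compact operators and the essential norm\<close>

text \<open>
  Were \<open>K\<close> unbounded on the unit ball, the images of some \<open>f\<^sub>n\<close> in it would have norms exceeding
  \<open>n\<close>, and no subsequence of them could converge.
\<close>

lemma compact_linear_op_bounded:
  assumes v: "\<And>z. z \<in> disk \<Longrightarrow> 0 \<le> v z" and K: "compact_linear_op X (H_inf v) K"
  shows "\<exists>B. \<forall>f\<in>elems X. fnorm X f \<le> 1 \<longrightarrow> fnorm (H_inf v) (K f) \<le> B"
proof (rule ccontr)
  assume "\<not> ?thesis"
  then have "\<forall>n::nat. \<exists>f\<in>elems X. fnorm X f \<le> 1 \<and> real n < fnorm (H_inf v) (K f)"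
    by (meson not_le)
  then obtain F where F: "\<And>n::nat. F n \<in> elems X" "\<And>n. fnorm X (F n) \<le> 1"
    "\<And>n. real n < fnorm (H_inf v) (K (F n))" by metis
  have KF: "K (F n) \<in> elems (H_inf v)" for n
    using K F(1) by (auto simp: compact_linear_op_def linear_op_def)
  have "range F \<subseteq> elems X" "\<exists>M. \<forall>n. fnorm X (F n) \<le> M" using F by auto
  then obtain g r where g: "g \<in> elems (H_inf v)" and r: "strict_mono (r :: nat \<Rightarrow> nat)"
    and lim: "(\<lambda>n. fnorm (H_inf v) (\<lambda>z. K (F (r n)) z - g z)) \<longlonglongrightarrow> 0"
    using K unfolding compact_linear_op_def by blast
  have "eventually (\<lambda>n. fnorm (H_inf v) (\<lambda>z. K (F (r n)) z - g z) < 1) sequentially"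
    using order_tendstoD(2)[OF lim, of 1] by simp
  moreover have "eventually (\<lambda>n. 1 + fnorm (H_inf v) g \<le> real n) sequentially"
    using filterlim_real_sequentially unfolding filterlim_at_top by blast
  ultimately have "eventually (\<lambda>n. False) sequentially"
  proof eventually_elim
    case (elim n)
    have "real n \<le> real (r n)" using seq_suble[OF r] by simp
    also have "\<dots> < fnorm (H_inf v) (K (F (r n)))" by (rule F)
    also have "\<dots> \<le> fnorm (H_inf v) (\<lambda>z. K (F (r n)) z - g z) + fnorm (H_inf v) g"
      using fnorm_H_inf_triangle_sub[OF v H_inf_diff(1)[OF v KF g] g] by simp
    finally show False using elim by linarith
  qed
  then show False by simp
qed

text \<open>
  A real infimum lies below the elements of its set only if that set is bounded below, so the operator
  norms of all the differences have to be nonnegative suprema of bounded sets. An operator that is at finite distance from one compact operator is bounded on the unit ball, hence at finite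
  distance from every compact operator.
\<close>

lemma ess_norm_le:
  assumes v: "\<And>z. z \<in> disk \<Longrightarrow> 0 \<le> v z"
    and T: "linear_op X (H_inf v) T" and K: "compact_linear_op X (H_inf v) K"
    and ne: "f0 \<in> elems X" "fnorm X f0 \<le> 1"
    and E: "\<And>f. f \<in> elems X \<Longrightarrow> fnorm X f \<le> 1 \<Longrightarrow> fnorm (H_inf v) (\<lambda>z. T f z - K f z) \<le> E"
  shows "ess_norm X (H_inf v) T \<le> E"
proof -
  have mem: "L f \<in> elems (H_inf v)" if "linear_op X (H_inf v) L" "f \<in> elems X" for L f
    using that by (auto simp: linear_op_def)
  have lin: "linear_op X (H_inf v) L" if "compact_linear_op X (H_inf v) L" for L
    using that by (simp add: compact_linear_op_def)
  obtain B where B: "\<And>f. f \<in> elems X \<Longrightarrow> fnorm X f \<le> 1 \<Longrightarrow> fnorm (H_inf v) (K f) \<le> B"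
    using compact_linear_op_bounded[OF v K] by blast
  have TB: "fnorm (H_inf v) (T f) \<le> E + B" if "f \<in> elems X" "fnorm X f \<le> 1" for f
    using fnorm_H_inf_triangle_sub[OF v H_inf_diff(1)[OF v mem[OF T that(1)] mem[OF lin[OF K] that(1)]]
        mem[OF lin[OF K] that(1)]] E[OF that] B[OF that] by simp
  have "0 \<le> op_norm X (H_inf v) (\<lambda>f z. T f z - L f z)" if L: "compact_linear_op X (H_inf v) L" for L
  proof -
    obtain B' where B': "\<And>f. f \<in> elems X \<Longrightarrow> fnorm X f \<le> 1 \<Longrightarrow> fnorm (H_inf v) (L f) \<le> B'"
      using compact_linear_op_bounded[OF v L] by blast
    have "fnorm (H_inf v) (\<lambda>z. T f z - L f z) \<le> E + B + B'"
      if "f \<in> elems X" "fnorm X f \<le> 1" for f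
      using H_inf_diff(2)[OF v mem[OF T that(1)] mem[OF lin[OF L] that(1)]]
        TB[OF that] B'[OF that] by simp
    then have "bdd_above ((\<lambda>f. fnorm (H_inf v) (\<lambda>z. T f z - L f z)) ` {f \<in> elems X. fnorm X f \<le> 1})"
      by (auto simp: bdd_above_def)
    then have "fnorm (H_inf v) (\<lambda>z. T f0 z - L f0 z) \<le> op_norm X (H_inf v) (\<lambda>f z. T f z - L f z)"
      unfolding op_norm_def using ne by (intro cSUP_upper) auto
    then show ?thesis
      using fnorm_H_inf_nonneg[OF v H_inf_diff(1)[OF v mem[OF T ne(1)] mem[OF lin[OF L] ne(1)]]]
      by linarith
  qed
  then have "bdd_below ((\<lambda>K. op_norm X (H_inf v) (\<lambda>f z. T f z - K f z)) ` {K. compact_linear_op X (H_inf v) K})"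
    by (auto simp: bdd_below_def)
  then have "ess_norm X (H_inf v) T \<le> op_norm X (H_inf v) (\<lambda>f z. T f z - K f z)"
    unfolding ess_norm_def using K by (intro cINF_lower) auto
  also have "\<dots> \<le> E"
    unfolding op_norm_def using ne E by (intro cSUP_least) auto
  finally show ?thesis .
qed

section \<open>The iterated logarithm and the norms of monomials\<close>

definition loglog :: "real \<Rightarrow> real" where
  "loglog t = ln (ln (4 / (1 - t\<^sup>2)))"

lemma w_log_eq: "w_log z = inverse (loglog (cmod z))"
  by (simp add: w_log_def loglog_def)

text \<open>
  Since \<open>4 > e\<close>, the inner logarithm exceeds 1, so the outer one is positive.
\<close>

lemma loglog_argument_bounds:
  fixes t :: real
  assumes "0 \<le> t" "t < 1"
  shows "0 < 1 - t\<^sup>2" "1 < ln (4 / (1 - t\<^sup>2))"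
proof -
  have "t\<^sup>2 < 1" using assms by (simp add: power_less_one_iff abs_square_less_1)
  then show pos: "0 < 1 - t\<^sup>2" by simp
  have "(3::real) \<le> 4 / (1 - t\<^sup>2)"
    using pos by (simp add: field_simps)
  then have "ln 3 \<le> ln (4 / (1 - t\<^sup>2))"
    using pos by (subst ln_le_cancel_iff) auto
  then show "1 < ln (4 / (1 - t\<^sup>2))" using ln3_gt_1 by linarith
qed

lemma loglog_mono:
  assumes "0 \<le> s" "s \<le> t" "t < 1"
  shows "loglog s \<le> loglog t"
proof -
  have "s\<^sup>2 \<le> t\<^sup>2" using assms by simp
  then have "4 / (1 - s\<^sup>2) \<le> 4 / (1 - t\<^sup>2)"
    using loglog_argument_bounds(1)[of t] loglog_argument_bounds(1)[of s] assms by (intro divide_left_mono) auto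
  then have "ln (4 / (1 - s\<^sup>2)) \<le> ln (4 / (1 - t\<^sup>2))"
    using loglog_argument_bounds(1)[of t] loglog_argument_bounds(1)[of s] assms by (subst ln_le_cancel_iff) auto
  then show ?thesis
    unfolding loglog_def using loglog_argument_bounds(2)[of t] loglog_argument_bounds(2)[of s] assms
    by (subst ln_le_cancel_iff) auto
qed

lemma loglog_0_pos: "0 < loglog 0"
  using loglog_argument_bounds(2)[of 0] by (simp add: loglog_def)

lemma loglog_pos: "0 \<le> t \<Longrightarrow> t < 1 \<Longrightarrow> 0 < loglog t"
  using loglog_0_pos loglog_mono[of 0 t] by linarith

text \<open>
  Scaling the argument of the double logarithm by a factor \<open>x \<ge> 1\<close> adds at most \<open>log x\<close>, because
  \<open>R + log x \<le> R x\<close> when \<open>R \<ge> 1\<close>. Here \<open>x = (1 - r) / (1 - a)\<close> dominates the factor by which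
  \<open>4 / (1 - t\<^sup>2)\<close> grows from \<open>r\<close> to \<open>a\<close>. The crude \<open>log x \<le> x\<close> is harmless, as this increment is
  later multiplied by \<open>exp (- x / 2)\<close>.
\<close>

lemma loglog_increment:
  assumes "0 \<le> r" "r \<le> a" "a < 1"
  shows "loglog a \<le> loglog r + (1 - r) / (1 - a)"
proof -
  define x where "x = (1 - r) / (1 - a)"
  define R where "R = ln (4 / (1 - r\<^sup>2))"
  have x: "1 \<le> x" using assms by (simp add: x_def field_simps)
  have R: "1 < R" using loglog_argument_bounds(2)[of r] assms by (simp add: R_def)
  have pos: "0 < 1 - r\<^sup>2" "0 < 1 - a\<^sup>2"
    using loglog_argument_bounds(1) assms by auto
  have "1 - r\<^sup>2 = (1 - r) * (1 + r)" by (simp add: algebra_simps power2_eq_square)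
  also have "\<dots> \<le> (1 - r) * (1 + a)" using assms by (intro mult_left_mono) auto
  also have "\<dots> = x * (1 - a\<^sup>2)"
    using assms by (simp add: x_def field_simps power2_eq_square)
  finally have "4 / (1 - a\<^sup>2) \<le> (4 / (1 - r\<^sup>2)) * x"
    using pos by (simp add: field_simps)
  then have "ln (4 / (1 - a\<^sup>2)) \<le> ln ((4 / (1 - r\<^sup>2)) * x)"
    using pos x by (subst ln_le_cancel_iff) auto
  also have "\<dots> = R + ln x" using pos x by (subst ln_mult) (auto simp: R_def)
  also have "\<dots> \<le> R * x"
  proof -
    have "ln x \<le> x - 1" using x by (intro ln_le_minus_one) auto
    also have "\<dots> \<le> R * (x - 1)" using R x mult_right_mono[of 1 R "x - 1"] by simp
    finally show ?thesis by (simp add: algebra_simps)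
  qed
  finally have "loglog a \<le> ln (R * x)"
    unfolding loglog_def using loglog_argument_bounds(2)[of a] assms R x
    by (subst ln_le_cancel_iff) auto
  also have "\<dots> = loglog r + ln x" using R x by (subst ln_mult) (auto simp: R_def loglog_def)
  also have "ln x \<le> x" using ln_le_minus_one[of x] x by linarith
  finally show ?thesis by (simp add: x_def)
qed

definition monomial_const :: real where
  "monomial_const = exp 1 * (1 + 2 / loglog 0)"

text \<open>
  The exponent for which \<open>z\<^sup>n\<close> starts to decay at distance of order \<open>1 - a\<close> from the unit circle.
\<close>

definition matching_exponent :: "real \<Rightarrow> nat" where
  "matching_exponent a = nat \<lfloor>1 / (2 * (1 - a))\<rfloor>"

lemma matching_exponent_bounds:
  assumes "a < 1"
  shows "real (matching_exponent a) * (1 - a) \<le> 1 / 2"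
    and "1 / (2 * (1 - a)) \<le> real (matching_exponent a) + 1"
proof -
  define y where "y = 1 / (2 * (1 - a))"
  have y: "0 < y" using assms by (simp add: y_def)
  then have n: "real (matching_exponent a) = of_int \<lfloor>y\<rfloor>"
    by (simp add: matching_exponent_def y_def)
  have "real (matching_exponent a) \<le> y" using n by linarith
  then show "real (matching_exponent a) * (1 - a) \<le> 1 / 2"
    using assms by (simp add: y_def field_simps)
  have "y \<le> real (matching_exponent a) + 1" unfolding n by linarith
  then show "1 / (2 * (1 - a)) \<le> real (matching_exponent a) + 1" by (simp add: y_def)
qed

lemma power_matching_exponent_ge:
  assumes "0 \<le> a" "a < 1"
  shows "1 / 2 \<le> a ^ matching_exponent a"
proof -
  have "1 / 2 \<le> 1 + real (matching_exponent a) * (a - 1)"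
    using matching_exponent_bounds(1)[of a] assms by (simp add: algebra_simps)
  also have "\<dots> \<le> a ^ matching_exponent a"
    using Bernoulli_inequality[of "a - 1" "matching_exponent a"] assms by simp
  finally show ?thesis .
qed

text \<open>
  For \<open>t \<ge> a\<close> monotonicity of \<open>loglog\<close> is enough. For \<open>t < a\<close> put \<open>x = (1 - t) / (1 - a)\<close>: passing
  from \<open>loglog t\<close> to \<open>loglog a\<close> costs a factor of at most \<open>1 + x / loglog 0\<close>, and the power
  \<open>t\<^sup>n \<le> e exp (- x / 2)\<close> absorbs it, because \<open>exp (- x / 2)\<close> and \<open>(x / 2) exp (- x / 2)\<close> are at
  most 1. The factor \<open>e\<close> pays for rounding the exponent down to an integer.
\<close>

lemma fnorm_monomial_le:
  assumes a: "0 \<le> a" "a < 1"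
  shows "fnorm (H_inf w_log) (\<lambda>z. z ^ matching_exponent a) \<le> monomial_const / loglog a"
proof -
  let ?n = "matching_exponent a"
  have "t ^ ?n / loglog t \<le> monomial_const / loglog a" if t: "0 \<le> t" "t < 1" for t
  proof (cases "a \<le> t")
    case True
    have "t ^ ?n / loglog t \<le> 1 / loglog a"
      using t True a loglog_mono[of a t] loglog_pos[of a]
      by (intro frac_le) (auto simp: power_le_one)
    also have "\<dots> \<le> monomial_const / loglog a"
    proof -
      have "1 \<le> monomial_const"
        unfolding monomial_const_def using loglog_0_pos one_le_exp_iff[of 1]
          mult_mono[of 1 "exp 1" 1 "1 + 2 / loglog 0"] by simp
      then show ?thesis using loglog_pos[of a] a by (intro divide_right_mono) auto
    qed
    finally show ?thesis .
  next
    case False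
    define x where "x = (1 - t) / (1 - a)"
    have x: "1 \<le> x" using a t False by (simp add: x_def)
    have "x / 2 - 1 \<le> real ?n * (1 - t)"
    proof -
      have "x / 2 = 1 / (2 * (1 - a)) * (1 - t)" using a by (simp add: x_def)
      also have "\<dots> \<le> (real ?n + 1) * (1 - t)"
        using matching_exponent_bounds(2)[of a] a t by (intro mult_right_mono) auto
      also have "\<dots> \<le> real ?n * (1 - t) + 1" using t by (simp add: algebra_simps)
      finally show ?thesis by simp
    qed
    have "t ^ ?n \<le> exp (t - 1) ^ ?n"
      using exp_ge_add_one_self[of "t - 1"] t by (intro power_mono) auto
    also have "\<dots> = exp (- (real ?n * (1 - t)))"
      by (simp add: exp_of_nat_mult[symmetric] algebra_simps)
    also have "\<dots> \<le> exp (1 - x / 2)" using \<open>x / 2 - 1 \<le> real ?n * (1 - t)\<close> by simp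
    finally have p: "t ^ ?n \<le> exp 1 * exp (- x / 2)" by (simp add: exp_add[symmetric])
    have "loglog a / loglog t \<le> (loglog t + x) / loglog t"
      using loglog_increment[of t a] t a False loglog_pos[of t]
      by (intro divide_right_mono) (auto simp: x_def)
    also have "\<dots> = 1 + x / loglog t" using loglog_pos[OF t] by (simp add: field_simps)
    also have "\<dots> \<le> 1 + x / loglog 0"
      using loglog_mono[of 0 t] t loglog_0_pos x
      by (intro add_left_mono divide_left_mono) auto
    finally have q: "loglog a / loglog t \<le> 1 + x / loglog 0" .
    have "t ^ ?n * (loglog a / loglog t) \<le> (exp 1 * exp (- x / 2)) * (1 + x / loglog 0)"
      using p q t a loglog_pos[of t] loglog_pos[of a] by (intro mult_mono) auto
    also have "\<dots> = exp 1 * (exp (- x / 2) + (x / 2 * exp (- x / 2)) * (2 / loglog 0))"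
      by (simp add: algebra_simps)
    also have "\<dots> \<le> monomial_const"
    proof -
      have "x / 2 \<le> exp (x / 2)" using exp_ge_add_one_self[of "x / 2"] by linarith
      then have "x / 2 * exp (- x / 2) \<le> 1" by (simp add: exp_minus field_simps)
      then have "(x / 2 * exp (- x / 2)) * (2 / loglog 0) \<le> 1 * (2 / loglog 0)"
        using loglog_0_pos by (intro mult_right_mono) auto
      moreover have "exp (- x / 2) \<le> 1" using x by simp
      ultimately have "exp (- x / 2) + (x / 2 * exp (- x / 2)) * (2 / loglog 0) \<le> 1 + 2 / loglog 0"
        by linarith
      then show ?thesis unfolding monomial_const_def by (rule mult_left_mono) simp
    qed
    finally show ?thesis using loglog_pos[of t] loglog_pos[of a] t a
      by (simp add: field_simps)
  qed
  then show ?thesis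
    unfolding H_inf_def fun_space.simps
    by (intro cSUP_least) (auto simp: w_log_eq norm_power divide_inverse mult.commute)
qed

lemma fnorm_monomial_pos: "0 < fnorm (H_inf w_log) (\<lambda>z. z ^ n)"
proof -
  have "w_log z * cmod (z ^ n) \<le> 1 / loglog 0" if "z \<in> disk" for z
  proof -
    have "w_log z \<le> 1 / loglog 0"
      using that loglog_mono[of 0 "cmod z"] loglog_0_pos
      by (simp add: w_log_eq inverse_eq_divide frac_le)
    moreover have "cmod (z ^ n) \<le> 1" using that by (simp add: norm_power power_le_one)
    ultimately show ?thesis
      using mult_mono[of "w_log z" "1 / loglog 0" "cmod (z ^ n)" 1] loglog_0_pos by simp
  qed
  \<comment> \<open>Any point of the disk other than 0 would do.\<close>
  then have "w_log (1/2) * cmod ((1/2) ^ n) \<le> fnorm (H_inf w_log) (\<lambda>z. z ^ n)"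
    by (rule fnorm_H_inf_ge) (simp_all add: norm_divide)
  moreover have "0 < w_log (1/2) * cmod ((1/2) ^ n)"
    using loglog_pos[of "1/2"] by (simp add: w_log_eq norm_power norm_divide)
  ultimately show ?thesis by linarith
qed

section \<open>The logarithmic Bloch space\<close>

lemma v_log_bounds:
  assumes "z \<in> disk"
  shows v_log_pos: "0 < v_log z" and v_log_ge: "cmod z \<le> \<rho> \<Longrightarrow> \<rho> < 1 \<Longrightarrow> (1 - \<rho>) * ln 2 \<le> v_log z"
proof -
  have "2 \<le> 2 / (1 - cmod z)" using assms by (simp add: field_simps)
  then have l: "ln 2 \<le> ln (2 / (1 - cmod z))" using assms by (subst ln_le_cancel_iff) auto
  then have "0 < ln (2 / (1 - cmod z))" using ln_gt_zero[of "2::real"] by linarith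
  then show "0 < v_log z" using assms by (simp add: v_log_def)
  show "(1 - \<rho>) * ln 2 \<le> v_log z" if "cmod z \<le> \<rho>" "\<rho> < 1"
    unfolding v_log_def using that l by (intro mult_mono) auto
qed

lemma Bloch_iff:
  "f \<in> elems (Bloch v) \<longleftrightarrow> f \<in> hol_disk \<and> (\<exists>B. \<forall>z\<in>disk. v z * cmod (deriv f z) \<le> B)"
proof -
  have "on_disk (deriv f) \<in> hol_disk" if "f \<in> hol_disk"
    using that by (intro on_disk_in_hol_disk holomorphic_deriv) (auto simp: hol_disk_def)
  then show ?thesis by (auto simp: Bloch_def H_inf_iff on_disk_def)
qed

lemma Bloch_deriv_le:
  assumes "f \<in> elems (Bloch v)" "z \<in> disk"
  shows "v z * cmod (deriv f z) \<le> fnorm (Bloch v) f - cmod (f 0)"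
proof -
  have "bdd_above ((\<lambda>z. v z * cmod (deriv f z)) ` disk)"
    using assms(1) unfolding Bloch_iff bdd_above_def by blast
  then have "v z * cmod (deriv f z) \<le> (SUP z\<in>disk. v z * cmod (deriv f z))"
    using assms(2) by (intro cSUP_upper) auto
  then show ?thesis by (simp add: Bloch_def)
qed

lemma fnorm_Bloch_nonneg:
  assumes v: "\<And>z. z \<in> disk \<Longrightarrow> 0 \<le> v z" and f: "f \<in> elems (Bloch v)"
  shows "0 \<le> fnorm (Bloch v) f"
proof -
  have "0 \<le> v 0 * cmod (deriv f 0)" using v[of 0] by simp
  also have "\<dots> \<le> fnorm (Bloch v) f - cmod (f 0)" by (rule Bloch_deriv_le[OF f]) simp
  finally show ?thesis using norm_ge_zero[of "f 0"] by linarith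
qed

lemma Bloch_holomorphic:
  "f \<in> elems (Bloch v) \<Longrightarrow> f holomorphic_on disk"
  by (simp add: Bloch_iff hol_disk_def)

lemma const_in_Bloch:
  "on_disk (\<lambda>_. c) \<in> elems (Bloch v)" "fnorm (Bloch v) (on_disk (\<lambda>_. c)) = cmod c"
proof -
  have hol: "on_disk (\<lambda>_. c) \<in> hol_disk" by (intro on_disk_in_hol_disk holomorphic_on_const)
  have d: "deriv (on_disk (\<lambda>_. c)) z = 0" if "z \<in> disk" for z
    using that complex_derivative_transform_within_open[of "on_disk (\<lambda>_. c)" disk "\<lambda>_. c" z] hol
    by (auto simp: hol_disk_def on_disk_def)
  show "on_disk (\<lambda>_. c) \<in> elems (Bloch v)"
    using d hol by (auto simp: Bloch_iff)
  show "fnorm (Bloch v) (on_disk (\<lambda>_. c)) = cmod c"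
    using d by (simp add: Bloch_def) (simp add: on_disk_def)
qed

text \<open>
  The term \<open>1 - ln (ln 2)\<close> collects \<open>|f(0)|\<close> and the value of \<open>- ln (ln (2 / (1 - t)))\<close> at the
  start of the radius; dividing it by \<open>loglog 0\<close>, the minimum of \<open>loglog\<close>, turns it into a multiple
  of \<open>loglog t\<close>.
\<close>

definition growth_const :: real where
  "growth_const = 1 + (1 - ln (ln 2)) / loglog 0"

lemma growth_const_pos: "0 < growth_const"
proof -
  have "ln (ln 2) < (0::real)" using ln_2_less_1 ln_gt_zero[of "2::real"] by (intro ln_less_zero) auto
  then have "0 < (1 - ln (ln 2)) / loglog 0" using loglog_0_pos by (intro divide_pos_pos) linarith+
  then show ?thesis by (simp add: growth_const_def)
qed

text \<open>
  On the radius towards \<open>z\<close> the derivative of \<open>f\<close> is dominated by that of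
  \<open>S log log (2 / (1 - t))\<close>, where \<open>S\<close> is what \<open>|f(0)|\<close> leaves of the norm of \<open>f\<close>. Moreover
  \<open>2 / (1 - t) \<le> 4 / (1 - t\<^sup>2)\<close>.
\<close>

lemma Bloch_growth:
  assumes f: "f \<in> elems (Bloch v_log)" and z: "z \<in> disk"
  shows "cmod (f z) \<le> growth_const * fnorm (Bloch v_log) f * loglog (cmod z)"
proof -
  define S where "S = fnorm (Bloch v_log) f - cmod (f 0)"
  \<comment> \<open>A primitive of \<open>1 / v_log\<close> along the radius.\<close>
  define h where "h = (\<lambda>t::real. ln (ln (2 / (1 - t))))"
  define e where "e = sgn z"
  have der: "v_log \<zeta> * cmod (deriv f \<zeta>) \<le> S" if "\<zeta> \<in> disk" for \<zeta>
    unfolding S_def by (rule Bloch_deriv_le[OF f that])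
  have S: "0 \<le> S"
    using order_trans[OF mult_nonneg_nonneg[OF less_imp_le[OF v_log_pos] norm_ge_zero] der, of 0] by simp
  have hol: "f holomorphic_on disk" by (rule Bloch_holomorphic[OF f])
  have ll: "0 < ln (2 / (1 - t))" if "0 \<le> t" "t < 1" for t :: real
    using that by (intro ln_gt_zero) (simp add: field_simps)
  have diff: "cmod (f z - f 0) \<le> S * h (cmod z) - S * h 0"
  proof (cases "z = 0")
    case False
    have e: "cmod e = 1" using False by (simp add: e_def norm_sgn)
    have inb: "of_real t * e \<in> disk" if "0 \<le> t" "t \<le> cmod z" for t
      using that e z by (simp add: norm_mult)
    have "cmod (f (of_real (cmod z) * e) - f (of_real 0 * e)) \<le> S * h (cmod z) - S * h 0"
    proof (rule differentiable_bound_general)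
      show "0 < cmod z" using False by simp
      show "continuous_on {0..cmod z} (\<lambda>t. f (of_real t * e))"
        by (rule continuous_on_compose2[OF holomorphic_on_imp_continuous_on[OF hol]])
          (use inb in \<open>auto intro!: continuous_intros\<close>)
      show "continuous_on {0..cmod z} (\<lambda>t. S * h t)"
        unfolding h_def
      proof (intro continuous_intros ballI)
        fix t assume "t \<in> {0..cmod z}"
        then have t: "0 \<le> t" "t < 1" using z by auto
        show "1 - t \<noteq> 0" "ln (2 / (1 - t)) \<noteq> 0" "2 / (1 - t) \<noteq> 0" using t ll[OF t] by auto
      qed
      fix t assume t: "0 < t" "t < cmod z"
      have t1: "0 \<le> t" "t < 1" using t z by auto
      show "((\<lambda>t. f (of_real t * e)) has_vector_derivative deriv f (of_real t * e) * e) (at t)"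
      proof (rule has_vector_derivative_real_field)
        have "(f has_field_derivative deriv f (of_real t * e)) (at (of_real t * e))"
          using holomorphic_derivI[OF hol open_ball inb[of t]] t by simp
        moreover have "((\<lambda>\<zeta>. \<zeta> * e) has_field_derivative e) (at (of_real t))"
          by (auto intro!: derivative_eq_intros)
        ultimately show "((\<lambda>\<zeta>. f (\<zeta> * e)) has_field_derivative deriv f (of_real t * e) * e) (at (of_real t))"
          by (rule DERIV_chain2[where g = "\<lambda>\<zeta>. \<zeta> * e"])
      qed
      have "(h has_real_derivative 1 / ((1 - t) * ln (2 / (1 - t)))) (at t)"
      proof -
        have "((\<lambda>t. ln (2 / (1 - t))) has_real_derivative 1 / (1 - t)) (at t)"
          using t1 by (auto intro!: derivative_eq_intros simp: divide_simps power2_eq_square)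
        from DERIV_chain2[OF DERIV_ln_divide[OF ll[OF t1]] this] show ?thesis
          by (simp add: h_def mult.commute)
      qed
      then have "((\<lambda>t. S * h t) has_real_derivative S * (1 / ((1 - t) * ln (2 / (1 - t))))) (at t)"
        by (rule DERIV_cmult)
      then show "((\<lambda>t. S * h t) has_vector_derivative S * (1 / ((1 - t) * ln (2 / (1 - t))))) (at t)"
        by (simp add: has_real_derivative_iff_has_vector_derivative)
      have "v_log (of_real t * e) = (1 - t) * ln (2 / (1 - t))"
        using e t by (simp add: v_log_def norm_mult)
      then have "cmod (deriv f (of_real t * e)) * ((1 - t) * ln (2 / (1 - t))) \<le> S"
        using der[OF inb[of t]] t by (simp add: mult.commute)
      then have "cmod (deriv f (of_real t * e)) \<le> S / ((1 - t) * ln (2 / (1 - t)))"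
        using t1 ll[OF t1] by (subst pos_le_divide_eq) auto
      then show "cmod (deriv f (of_real t * e) * e) \<le> S * (1 / ((1 - t) * ln (2 / (1 - t))))"
        using e by (simp add: norm_mult)
    qed
    moreover have "of_real (cmod z) * e = z" by (simp add: e_def sgn_eq)
    ultimately show ?thesis by simp
  qed simp
  have "h (cmod z) \<le> loglog (cmod z)"
  proof -
    have c: "cmod z < 1" using z by simp
    have "2 / (1 - cmod z) \<le> 4 / (1 - (cmod z)\<^sup>2)"
    proof -
      have "1 - (cmod z)\<^sup>2 = (1 - cmod z) * (1 + cmod z)" by (simp add: algebra_simps power2_eq_square)
      also have "\<dots> \<le> (1 - cmod z) * 2" using c by (intro mult_left_mono) auto
      finally show ?thesis using c loglog_argument_bounds(1)[of "cmod z"] by (simp add: field_simps)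
    qed
    then have "ln (2 / (1 - cmod z)) \<le> ln (4 / (1 - (cmod z)\<^sup>2))"
      using c loglog_argument_bounds(1)[of "cmod z"] by (subst ln_le_cancel_iff) auto
    then show ?thesis
      unfolding h_def loglog_def using c ll[of "cmod z"] loglog_argument_bounds(2)[of "cmod z"]
      by (subst ln_le_cancel_iff) auto
  qed
  then have "S * h (cmod z) \<le> S * loglog (cmod z)" using S by (rule mult_left_mono)
  have L: "loglog 0 \<le> loglog (cmod z)" using z by (intro loglog_mono) auto
  have h0: "h 0 < 0"
    unfolding h_def using ln_2_less_1 ln_gt_zero[of "2::real"] by (intro ln_less_zero) auto
  have "cmod (f z) \<le> cmod (f 0) + cmod (f z - f 0)" by (metis norm_triangle_sub)
  also have "\<dots> \<le> cmod (f 0) + S * (loglog (cmod z) - h 0)"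
    using diff \<open>S * h (cmod z) \<le> S * loglog (cmod z)\<close> by (simp add: right_diff_distrib)
  also have "\<dots> \<le> cmod (f 0) * (loglog (cmod z) + (1 - h 0)) + S * (loglog (cmod z) + (1 - h 0))"
    using S L loglog_0_pos h0 mult_left_mono[of 1 "loglog (cmod z) + (1 - h 0)" "cmod (f 0)"]
    by (intro add_mono mult_left_mono) auto
  also have "\<dots> = fnorm (Bloch v_log) f * (loglog (cmod z) + (1 - h 0))"
    by (simp add: S_def algebra_simps)
  also have "\<dots> \<le> fnorm (Bloch v_log) f * (growth_const * loglog (cmod z))"
  proof (rule mult_left_mono)
    have "1 - h 0 = (1 - h 0) / loglog 0 * loglog 0" using loglog_0_pos by simp
    also have "\<dots> \<le> (1 - h 0) / loglog 0 * loglog (cmod z)"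
      using L h0 loglog_0_pos by (intro mult_left_mono) auto
    finally show "loglog (cmod z) + (1 - h 0) \<le> growth_const * loglog (cmod z)"
      by (simp add: growth_const_def h_def distrib_right)
    show "0 \<le> fnorm (Bloch v_log) f"
      by (rule fnorm_Bloch_nonneg[OF _ f]) (simp add: v_log_pos less_imp_le)
  qed
  finally show ?thesis by (simp add: mult_ac)
qed

section \<open>Compact approximants by dilation\<close>

definition dilated_wcomp :: "(complex \<Rightarrow> complex) \<Rightarrow> (complex \<Rightarrow> complex) \<Rightarrow> real \<Rightarrow> fun_op" where
  "dilated_wcomp u \<phi> r f = wcomp u \<phi> (\<lambda>z. f (of_real r * z))"

text \<open>
  The factor \<open>f (r \<phi>(z))\<close> is bounded because \<open>r \<phi>(z)\<close> stays in a compact disk. This covers every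
  \<open>f\<close> holomorphic on the disk, in particular limits of Bloch functions.
\<close>

lemma dilated_wcomp_mem:
  assumes u: "u holomorphic_on disk" and \<phi>: "\<phi> holomorphic_on disk" "\<phi> ` disk \<subseteq> disk"
    and v: "\<And>z. z \<in> disk \<Longrightarrow> 0 \<le> v z" and U: "\<And>z. z \<in> disk \<Longrightarrow> v z * cmod (u z) \<le> U"
    and r: "0 \<le> r" "r < 1" and f: "f holomorphic_on disk"
  shows "dilated_wcomp u \<phi> r f \<in> elems (H_inf v)"
proof -
  have r\<phi>: "of_real r * \<phi> z \<in> cball 0 r" if "z \<in> disk" for z
  proof -
    have "cmod (\<phi> z) < 1" using \<phi>(2) that by (auto simp: image_subset_iff)
    then show ?thesis using r mult_left_mono[of "cmod (\<phi> z)" 1 r] by (simp add: norm_mult)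
  qed
  have sub: "cball 0 r \<subseteq> disk" using r by auto
  have "compact (f ` cball 0 r)"
    using holomorphic_on_imp_continuous_on[OF f] sub
    by (intro compact_continuous_image) (auto intro: continuous_on_subset)
  then obtain B where B: "\<And>w. w \<in> cball 0 r \<Longrightarrow> cmod (f w) \<le> B"
    by (fastforce dest!: compact_imp_bounded simp: bounded_iff)
  have "(\<lambda>z. u z * f (of_real r * \<phi> z)) holomorphic_on disk"
  proof (intro holomorphic_on_mult u)
    have "f \<circ> (\<lambda>z. of_real r * \<phi> z) holomorphic_on disk"
      using r\<phi> sub by (intro holomorphic_on_compose_gen[OF _ f] holomorphic_intros \<phi>(1)) auto
    then show "(\<lambda>z. f (of_real r * \<phi> z)) holomorphic_on disk" by (simp add: o_def)
  qed
  then have "dilated_wcomp u \<phi> r f \<in> hol_disk"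
    unfolding dilated_wcomp_def wcomp_def by (rule on_disk_in_hol_disk)
  moreover have "v z * cmod (dilated_wcomp u \<phi> r f z) \<le> U * B" if "z \<in> disk" for z
  proof -
    have "(v z * cmod (u z)) * cmod (f (of_real r * \<phi> z)) \<le> U * B"
      using U[OF that] B[OF r\<phi>[OF that]] v[OF that]
      by (intro mult_mono) (auto intro: order_trans[of 0 "v z * cmod (u z)"])
    then show ?thesis using that by (simp add: dilated_wcomp_def wcomp_def on_disk_def norm_mult mult.assoc)
  qed
  ultimately show ?thesis unfolding H_inf_iff by blast
qed

text \<open>
  By the growth estimate a norm-bounded sequence in the Bloch space is a normal family, and a locally
  uniform limit \<open>g\<close> is uniform on the disk of radius \<open>r\<close>. The image of \<open>g\<close> lies in the target space
  whether or not \<open>g\<close> is a Bloch function.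
\<close>

lemma compact_dilated_wcomp:
  assumes u: "u holomorphic_on disk" and \<phi>: "\<phi> holomorphic_on disk" "\<phi> ` disk \<subseteq> disk"
    and v: "\<And>z. z \<in> disk \<Longrightarrow> 0 \<le> v z" and U: "\<And>z. z \<in> disk \<Longrightarrow> v z * cmod (u z) \<le> U"
    and r: "0 \<le> r" "r < 1"
  shows "compact_linear_op (Bloch v_log) (H_inf v) (dilated_wcomp u \<phi> r)"
  unfolding compact_linear_op_def
proof (intro conjI allI impI)
  note mem = dilated_wcomp_mem[OF u \<phi> v U r]
  show "linear_op (Bloch v_log) (H_inf v) (dilated_wcomp u \<phi> r)"
    unfolding linear_op_def
    using mem[OF _ _ Bloch_holomorphic]
    by (auto simp: dilated_wcomp_def wcomp_def on_disk_def algebra_simps)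
  fix F :: "nat \<Rightarrow> complex \<Rightarrow> complex"
  assume "range F \<subseteq> elems (Bloch v_log) \<and> (\<exists>M. \<forall>n. fnorm (Bloch v_log) (F n) \<le> M)"
  then obtain M where F: "\<And>n. F n \<in> elems (Bloch v_log)" "\<And>n. fnorm (Bloch v_log) (F n) \<le> M"
    by auto
  define \<H> where "\<H> = {h. h holomorphic_on disk \<and> (\<forall>z\<in>disk. cmod (h z) \<le> growth_const * M * loglog (cmod z))}"
  have M: "0 \<le> M"
    using order_trans[OF fnorm_Bloch_nonneg[OF _ F(1)] F(2)] v_log_pos by (meson less_imp_le)
  have rng: "range F \<subseteq> \<H>"
  proof (clarsimp simp: \<H>_def Bloch_holomorphic[OF F(1)])
    fix n z assume z: "cmod z < 1"
    have "cmod (F n z) \<le> growth_const * fnorm (Bloch v_log) (F n) * loglog (cmod z)"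
      using Bloch_growth[OF F(1)] z by simp
    also have "\<dots> \<le> growth_const * M * loglog (cmod z)"
      using F(2) growth_const_pos loglog_pos[of "cmod z"] z by (intro mult_right_mono mult_left_mono) auto
    finally show "cmod (F n z) \<le> growth_const * M * loglog (cmod z)" .
  qed
  have bdd: "\<exists>B. \<forall>h\<in>\<H>. \<forall>z\<in>K. cmod (h z) \<le> B" if K: "compact K" "K \<subseteq> disk" for K
  proof (cases "K = {}")
    case False
    obtain x where x: "x \<in> K" "\<And>y. y \<in> K \<Longrightarrow> cmod y \<le> cmod x"
      using continuous_attains_sup[OF K(1) False, of cmod] by (auto intro: continuous_intros)
    have "cmod (h z) \<le> growth_const * M * loglog (cmod x)" if "h \<in> \<H>" "z \<in> K" for h z
    proof -
      have "cmod (h z) \<le> growth_const * M * loglog (cmod z)" using that K by (auto simp: \<H>_def)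
      also have "\<dots> \<le> growth_const * M * loglog (cmod x)"
        using x that K M growth_const_pos by (intro mult_left_mono loglog_mono) auto
      finally show ?thesis .
    qed
    then show ?thesis by blast
  qed simp
  obtain g \<sigma> where g: "g holomorphic_on disk" and \<sigma>: "strict_mono (\<sigma> :: nat \<Rightarrow> nat)"
    and unif: "\<And>K. compact K \<Longrightarrow> K \<subseteq> disk \<Longrightarrow> uniform_limit K (F \<circ> \<sigma>) g sequentially"
    by (rule Montel[of disk \<H> F, OF open_ball _ bdd rng]) (auto simp: \<H>_def)
  define G where "G = dilated_wcomp u \<phi> r g"
  have G: "G \<in> elems (H_inf v)" unfolding G_def using mem[OF _ _ g] by simp
  have U0: "0 \<le> U"
    using order_trans[OF mult_nonneg_nonneg[OF v norm_ge_zero] U, of 0] by simp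
  have "(\<lambda>n. fnorm (H_inf v) (\<lambda>z. dilated_wcomp u \<phi> r (F (\<sigma> n)) z - G z)) \<longlonglongrightarrow> 0"
  proof (rule LIMSEQ_I)
    fix \<epsilon> :: real assume \<epsilon>: "0 < \<epsilon>"
    define \<eta> where "\<eta> = \<epsilon> / (2 * (U + 1))"
    have \<eta>: "0 < \<eta>" using \<epsilon> U0 by (simp add: \<eta>_def)
    have U\<eta>: "U * \<eta> < \<epsilon>" using \<epsilon> U0 by (simp add: \<eta>_def field_simps add_nonneg_pos)
    have "uniform_limit (cball 0 r) (F \<circ> \<sigma>) g sequentially"
      using r by (intro unif) auto
    then obtain N where N: "\<And>n w. N \<le> n \<Longrightarrow> cmod w \<le> r \<Longrightarrow> cmod (F (\<sigma> n) w - g w) < \<eta>"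
      using \<eta> unfolding uniform_limit_sequentially_iff by (fastforce simp: dist_norm)
    have "norm (fnorm (H_inf v) (\<lambda>z. dilated_wcomp u \<phi> r (F (\<sigma> n)) z - G z) - 0) < \<epsilon>" if n: "N \<le> n" for n
    proof -
      have "fnorm (H_inf v) (\<lambda>z. dilated_wcomp u \<phi> r (F (\<sigma> n)) z - G z) \<le> U * \<eta>"
      proof (rule fnorm_H_inf_le)
        fix z assume z: "z \<in> disk"
        have "cmod (\<phi> z) < 1" using \<phi>(2) z by (auto simp: image_subset_iff)
        then have "cmod (of_real r * \<phi> z) \<le> r"
          using r mult_left_mono[of "cmod (\<phi> z)" 1 r] by (simp add: norm_mult)
        then have "(v z * cmod (u z)) * cmod (F (\<sigma> n) (of_real r * \<phi> z) - g (of_real r * \<phi> z)) \<le> U * \<eta>"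
          using U[OF z] U0 N[OF n] v[OF z] by (intro mult_mono) (auto simp: less_imp_le)
        then show "v z * cmod (dilated_wcomp u \<phi> r (F (\<sigma> n)) z - G z) \<le> U * \<eta>"
          using z by (simp add: G_def dilated_wcomp_def wcomp_def on_disk_def norm_mult mult.assoc
              flip: right_diff_distrib)
      qed
      moreover have "0 \<le> fnorm (H_inf v) (\<lambda>z. dilated_wcomp u \<phi> r (F (\<sigma> n)) z - G z)"
        using mem[OF _ _ Bloch_holomorphic[OF F(1)]]
        by (intro fnorm_H_inf_nonneg[OF v] H_inf_diff(1)[OF v _ G]) auto
      ultimately show ?thesis using U\<eta> by simp
    qed
    then show "\<exists>N. \<forall>n\<ge>N. norm (fnorm (H_inf v) (\<lambda>z. dilated_wcomp u \<phi> r (F (\<sigma> n)) z - G z) - 0) < \<epsilon>"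
      by blast
  qed
  then show "\<exists>g\<in>elems (H_inf v). \<exists>\<sigma>. strict_mono \<sigma> \<and>
      (\<lambda>n. fnorm (H_inf v) (\<lambda>z. dilated_wcomp u \<phi> r (F (\<sigma> n)) z - g z)) \<longlonglongrightarrow> 0"
    using G \<sigma> by blast
qed

section \<open>The essential norm estimate\<close>

lemma weighted_power_le_fnorm:
  assumes \<phi>: "\<phi> ` disk \<subseteq> disk"
    and v: "\<And>z. z \<in> disk \<Longrightarrow> 0 \<le> v z" and U: "\<And>z. z \<in> disk \<Longrightarrow> v z * cmod (u z) \<le> U"
    and z: "z \<in> disk"
  shows "v z * cmod (u z * \<phi> z ^ n) \<le> fnorm (H_inf v) (\<lambda>z. u z * \<phi> z ^ n)"
proof (rule fnorm_H_inf_ge[OF _ z])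
  fix \<zeta> :: complex assume \<zeta>: "\<zeta> \<in> disk"
  have "cmod (\<phi> \<zeta>) ^ n \<le> 1"
    using \<phi> \<zeta> by (intro power_le_one) (auto simp: image_subset_iff less_imp_le)
  then have "(v \<zeta> * cmod (u \<zeta>)) * cmod (\<phi> \<zeta>) ^ n \<le> v \<zeta> * cmod (u \<zeta>)"
    using v[OF \<zeta>] by (intro mult_right_le_one_le) auto
  then show "v \<zeta> * cmod (u \<zeta> * \<phi> \<zeta> ^ n) \<le> U"
    using U[OF \<zeta>] by (simp add: norm_mult norm_power mult.assoc)
qed

text \<open>
  Apply the operator to the constant function 1.
\<close>

lemma wcomp_weight_bounded:
  assumes \<phi>: "\<phi> ` disk \<subseteq> disk" and W: "linear_op (Bloch v') (H_inf v) (wcomp u \<phi>)"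
  obtains U where "\<And>z. z \<in> disk \<Longrightarrow> v z * cmod (u z) \<le> U"
proof -
  have "wcomp u \<phi> (on_disk (\<lambda>_. 1)) \<in> elems (H_inf v)"
    using W const_in_Bloch(1) by (auto simp: linear_op_def)
  then obtain U where U: "\<And>z. z \<in> disk \<Longrightarrow> v z * cmod (wcomp u \<phi> (on_disk (\<lambda>_. 1)) z) \<le> U"
    unfolding H_inf_iff by blast
  have "v z * cmod (u z) \<le> U" if "z \<in> disk" for z
    using U[OF that] that \<phi> by (auto simp: wcomp_def on_disk_def image_subset_iff)
  then show thesis by (rule that)
qed

text \<open>
  Evaluate the norm of \<open>u \<phi>\<^sup>n\<close> at \<open>z\<close> itself, with the exponent \<open>n\<close> that matches \<open>a = |\<phi>(z)|\<close>: the
  factor \<open>a\<^sup>n \<ge> 1/2\<close> is lost, and the monomial on the right has norm of order \<open>1 / loglog a\<close>. The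
  condition on \<open>|\<phi>(z)|\<close> makes this exponent at least \<open>N\<close>.
\<close>

lemma weight_le_of_power_norms:
  assumes \<phi>: "\<phi> ` disk \<subseteq> disk"
    and v: "\<And>z. z \<in> disk \<Longrightarrow> 0 \<le> v z" and U: "\<And>z. z \<in> disk \<Longrightarrow> v z * cmod (u z) \<le> U"
    and M: "0 \<le> M"
    and le: "\<And>n. N \<le> n \<Longrightarrow> fnorm (H_inf v) (\<lambda>z. u z * \<phi> z ^ n) \<le> M * fnorm (H_inf w_log) (\<lambda>z. z ^ n)"
    and z: "z \<in> disk" and far: "1 - 1 / (2 * (real N + 1)) \<le> cmod (\<phi> z)"
  shows "v z * cmod (u z) \<le> 2 * monomial_const * M / loglog (cmod (\<phi> z))"
proof -
  define a where "a = cmod (\<phi> z)"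
  let ?n = "matching_exponent a"
  have a: "0 \<le> a" "a < 1" using \<phi> z by (auto simp: a_def image_subset_iff)
  have "real N + 1 \<le> 1 / (2 * (1 - a))"
    using far a by (simp add: a_def[symmetric] field_simps)
  then have n: "N \<le> ?n" using matching_exponent_bounds(2)[OF a(2)] by linarith
  have "v z * cmod (u z * \<phi> z ^ ?n) \<le> fnorm (H_inf v) (\<lambda>z. u z * \<phi> z ^ ?n)"
    by (rule weighted_power_le_fnorm[OF \<phi> v U z])
  also have "\<dots> \<le> M * fnorm (H_inf w_log) (\<lambda>z. z ^ ?n)" by (rule le[OF n])
  also have "\<dots> \<le> M * (monomial_const / loglog a)"
    using fnorm_monomial_le[OF a] M by (rule mult_left_mono)
  finally have *: "(v z * cmod (u z)) * a ^ ?n \<le> M * (monomial_const / loglog a)"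
    by (simp add: a_def norm_mult norm_power mult.assoc)
  have "(v z * cmod (u z)) * (1 / 2) \<le> (v z * cmod (u z)) * a ^ ?n"
    using power_matching_exponent_ge[OF a] v[OF z] by (intro mult_left_mono) auto
  also note *
  finally show ?thesis by (simp add: a_def field_simps)
qed

text \<open>
  The two factors of 2 come from \<open>a\<^sup>n \<ge> 1/2\<close> and from bounding \<open>f (w) - f (r w)\<close> by two values.
\<close>

definition ess_const :: real where
  "ess_const = 4 * monomial_const * growth_const"

lemma ess_const_pos: "0 < ess_const"
  using growth_const_pos loglog_0_pos by (simp add: ess_const_def monomial_const_def add_pos_pos)

text \<open>
  The radius \<open>\<rho>\<close> separates the points where \<open>v |u|\<close> is controlled by \<open>M\<close> from those where \<open>f'\<close> is
  bounded by \<open>1 / ((1 - \<rho>) ln 2)\<close>. Only then is the dilation factor \<open>r\<close> chosen, so close to 1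
  that the second region contributes at most what the first one does.
\<close>

lemma ess_norm_wcomp_le:
  assumes u: "u holomorphic_on disk" and \<phi>: "\<phi> holomorphic_on disk" "\<phi> ` disk \<subseteq> disk"
    and v: "\<And>z. z \<in> disk \<Longrightarrow> 0 \<le> v z"
    and W: "linear_op (Bloch v_log) (H_inf v) (wcomp u \<phi>)"
    and M: "0 < M"
    and le: "\<And>n. N \<le> n \<Longrightarrow> fnorm (H_inf v) (\<lambda>z. u z * \<phi> z ^ n) \<le> M * fnorm (H_inf w_log) (\<lambda>z. z ^ n)"
  shows "ess_norm (Bloch v_log) (H_inf v) (wcomp u \<phi>) \<le> ess_const * M"
proof -
  obtain U where U: "\<And>z. z \<in> disk \<Longrightarrow> v z * cmod (u z) \<le> U"
    using wcomp_weight_bounded[OF \<phi>(2) W] by blast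
  have U0: "0 \<le> U"
    using order_trans[OF mult_nonneg_nonneg[OF v norm_ge_zero] U, of 0] by simp
  define \<rho> where "\<rho> = 1 - 1 / (2 * (real N + 1))"
  have \<rho>: "0 \<le> \<rho>" "\<rho> < 1" by (auto simp: \<rho>_def field_simps)
  \<comment> \<open>The tolerance for \<open>1 - r\<close>; the summand 1 covers the case \<open>U = 0\<close>.\<close>
  define \<delta> where "\<delta> = ess_const * M * ((1 - \<rho>) * ln 2) / (U + 1)"
  have \<delta>: "0 < \<delta>" using ess_const_pos M \<rho> U0 by (simp add: \<delta>_def)
  define r where "r = max 0 (1 - \<delta>)"
  have r: "0 \<le> r" "r < 1" "1 - r \<le> \<delta>" using \<delta> by (auto simp: r_def)
  show ?thesis
  proof (rule ess_norm_le[OF v W compact_dilated_wcomp[OF u \<phi> v U r(1,2)]])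
    \<comment> \<open>The zero function shows that the unit ball is inhabited.\<close>
    show "on_disk (\<lambda>_. 0) \<in> elems (Bloch v_log)" by (rule const_in_Bloch)
    show "fnorm (Bloch v_log) (on_disk (\<lambda>_. 0)) \<le> 1" by (simp add: const_in_Bloch)
    fix f assume f: "f \<in> elems (Bloch v_log)" "fnorm (Bloch v_log) f \<le> 1"
    have gr: "cmod (f w) \<le> growth_const * loglog (cmod w)" if "w \<in> disk" for w
    proof -
      have "growth_const * fnorm (Bloch v_log) f * loglog (cmod w) \<le> growth_const * 1 * loglog (cmod w)"
        using f(2) growth_const_pos loglog_pos[of "cmod w"] that
        by (intro mult_right_mono mult_left_mono) auto
      then show ?thesis using Bloch_growth[OF f(1) that] by simp
    qed
    show "fnorm (H_inf v) (\<lambda>z. wcomp u \<phi> f z - dilated_wcomp u \<phi> r f z) \<le> ess_const * M"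
    proof (rule fnorm_H_inf_le)
      fix z assume z: "z \<in> disk"
      define w where "w = \<phi> z"
      define w' where "w' = of_real r * w"
      have w: "cmod w < 1" using \<phi>(2) z by (auto simp: w_def image_subset_iff)
      have w': "cmod w' \<le> cmod w"
        using r by (simp add: w'_def norm_mult mult_left_le_one_le)
      have "(v z * cmod (u z)) * cmod (f w - f w') \<le> ess_const * M"
      proof (cases "\<rho> \<le> cmod w")
        case True
        have L: "0 < loglog (cmod w)" using w by (intro loglog_pos) auto
        have "cmod (f w - f w') \<le> cmod (f w) + cmod (f w')" by (rule norm_triangle_ineq4)
        also have "\<dots> \<le> growth_const * loglog (cmod w) + growth_const * loglog (cmod w')"
          using gr[of w] gr[of w'] w w' by (intro add_mono) auto
        also have "growth_const * loglog (cmod w') \<le> growth_const * loglog (cmod w)"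
          using w w' growth_const_pos by (intro mult_left_mono loglog_mono) auto
        finally have "cmod (f w - f w') \<le> 2 * growth_const * loglog (cmod w)" by simp
        moreover have "v z * cmod (u z) \<le> 2 * monomial_const * M / loglog (cmod w)"
          using weight_le_of_power_norms[OF \<phi>(2) v U _ le z] M True by (simp add: \<rho>_def w_def)
        ultimately have "(v z * cmod (u z)) * cmod (f w - f w')
            \<le> (2 * monomial_const * M / loglog (cmod w)) * (2 * growth_const * loglog (cmod w))"
          using v[OF z] by (intro mult_mono) (auto intro: order_trans[of 0 "v z * cmod (u z)"])
        also have "\<dots> = ess_const * M" using L by (simp add: ess_const_def)
        finally show ?thesis .
      next
        case False
        let ?B = "1 / ((1 - \<rho>) * ln 2)"
        have "cmod (f w - f w') \<le> ?B * cmod (w - w')"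
        proof (rule field_differentiable_bound[where S = "cball 0 \<rho>" and f' = "deriv f"])
          fix \<zeta> :: complex assume "\<zeta> \<in> cball 0 \<rho>"
          then have \<zeta>: "cmod \<zeta> \<le> \<rho>" "\<zeta> \<in> disk" using \<rho> by auto
          show "(f has_field_derivative deriv f \<zeta>) (at \<zeta> within cball 0 \<rho>)"
            using holomorphic_derivI[OF Bloch_holomorphic[OF f(1)] open_ball \<zeta>(2)]
            by (rule has_field_derivative_at_within)
          have "((1 - \<rho>) * ln 2) * cmod (deriv f \<zeta>) \<le> v_log \<zeta> * cmod (deriv f \<zeta>)"
            using v_log_ge[OF \<zeta>(2,1) \<rho>(2)] by (rule mult_right_mono) simp
          also have "\<dots> \<le> 1"
            using Bloch_deriv_le[OF f(1) \<zeta>(2)] f(2) norm_ge_zero[of "f 0"] by linarith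
          finally show "cmod (deriv f \<zeta>) \<le> ?B" using \<rho> by (simp add: field_simps)
        qed (use False w' in auto)
        also have "\<dots> \<le> ?B * \<delta>"
        proof (intro mult_left_mono)
          have "w - w' = of_real (1 - r) * w" by (simp add: w'_def algebra_simps)
          then have "cmod (w - w') = (1 - r) * cmod w" using r by (simp add: norm_mult del: of_real_diff)
          also have "\<dots> \<le> 1 - r" using r w by (intro mult_right_le_one_le) auto
          finally show "cmod (w - w') \<le> \<delta>" using r by simp
        qed (use \<rho> in auto)
        finally have "(v z * cmod (u z)) * cmod (f w - f w') \<le> U * (?B * \<delta>)"
          using U[OF z] U0 by (intro mult_mono) auto
        also have "\<dots> = ess_const * M * (U / (U + 1))" using \<rho> by (simp add: \<delta>_def)
        also have "\<dots> \<le> ess_const * M" using ess_const_pos M U0 by (intro mult_right_le_one_le) auto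
        finally show ?thesis .
      qed
      then show "v z * cmod (wcomp u \<phi> f z - dilated_wcomp u \<phi> r f z) \<le> ess_const * M"
        using z by (simp add: dilated_wcomp_def wcomp_def on_disk_def w_def w'_def norm_mult mult.assoc
            flip: right_diff_distrib)
    qed
  qed
qed

theorem corollary3p2:
  fixes u \<phi> :: "complex \<Rightarrow> complex"
  assumes "u holomorphic_on disk"
    and "\<phi> holomorphic_on disk"
    and "\<phi> ` disk \<subseteq> disk"
    and "continuous_linear_op (Bloch v_log) (H_inf v_log) (wcomp u \<phi>)"
  shows "\<exists>C>0. ereal (ess_norm (Bloch v_log) (H_inf v_log) (wcomp u \<phi>))
    \<le> ereal C * limsup (\<lambda>n. ereal (fnorm (H_inf v_log) (\<lambda>z. u z * \<phi> z ^ n)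
                                   / fnorm (H_inf w_log) (\<lambda>z. z ^ n)))"
proof -
  let ?ess = "ess_norm (Bloch v_log) (H_inf v_log) (wcomp u \<phi>)"
  define q where "q n = fnorm (H_inf v_log) (\<lambda>z. u z * \<phi> z ^ n) / fnorm (H_inf w_log) (\<lambda>z. z ^ n)" for n
  have v: "0 \<le> v_log z" if "z \<in> disk" for z using v_log_pos[OF that] by simp
  have W: "linear_op (Bloch v_log) (H_inf v_log) (wcomp u \<phi>)"
    using assms(4) by (simp add: continuous_linear_op_def)
  obtain U where U: "\<And>z. z \<in> disk \<Longrightarrow> v_log z * cmod (u z) \<le> U"
    using wcomp_weight_bounded[OF assms(3) W] by blast
  have bound: "?ess \<le> ess_const * M" if M: "0 < M" "limsup (\<lambda>n. ereal (q n)) < ereal M" for M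
  proof -
    have "eventually (\<lambda>n. ereal (q n) < ereal M) sequentially" by (rule Limsup_lessD[OF M(2)])
    then obtain N where "\<And>n. N \<le> n \<Longrightarrow> q n < M" by (auto simp: eventually_sequentially)
    then have "fnorm (H_inf v_log) (\<lambda>z. u z * \<phi> z ^ n) \<le> M * fnorm (H_inf w_log) (\<lambda>z. z ^ n)"
      if "N \<le> n" for n
      using that fnorm_monomial_pos[of n] by (fastforce simp: q_def field_simps)
    then show ?thesis using ess_norm_wcomp_le[OF assms(1-3) v W M(1)] by blast
  qed
  have "ereal ?ess \<le> ereal ess_const * limsup (\<lambda>n. ereal (q n))"
  proof (cases "limsup (\<lambda>n. ereal (q n)) = \<infinity>")
    case True
    then show ?thesis using ess_const_pos by simp
  next
    case False
    have "0 \<le> q n" for n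
    proof -
      have "0 \<le> v_log 0 * cmod (u 0 * \<phi> 0 ^ n)" using v[of 0] by simp
      also have "\<dots> \<le> fnorm (H_inf v_log) (\<lambda>z. u z * \<phi> z ^ n)"
        by (rule weighted_power_le_fnorm[OF assms(3) v U]) auto
      finally show ?thesis using fnorm_monomial_pos[of n] by (simp add: q_def)
    qed
    then have "0 \<le> limsup (\<lambda>n. ereal (q n))"
      by (intro le_Limsup) (auto intro: always_eventually)
    with False obtain l where l: "limsup (\<lambda>n. ereal (q n)) = ereal l" "0 \<le> l"
      by (cases "limsup (\<lambda>n. ereal (q n))") auto
    \<comment> \<open>The slack makes the bound on the quotients strict and, when \<open>l = 0\<close>, positive.\<close>
    have "?ess \<le> ess_const * l + \<epsilon>" if "0 < \<epsilon>" for \<epsilon>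
    proof -
      have "?ess \<le> ess_const * (l + \<epsilon> / ess_const)"
        using l that ess_const_pos by (intro bound) (auto simp: add_nonneg_pos)
      then show ?thesis using ess_const_pos by (simp add: distrib_left)
    qed
    then have "?ess \<le> ess_const * l" by (rule field_le_epsilon)
    then show ?thesis using l by simp
  qed
  then show ?thesis unfolding q_def using ess_const_pos by blast
qed
end
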